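(* Let $(K,\tau)$ be a compact Hausdorff topological space. If $K$ contains a subset that is not a Borel set, i.e. $\operatorname{Bo}(K,\tau)\neq P(K)$, then $\operatorname{Bo}(C^*(K),w^* )\neq\operatorname{Bo}(C^*(K),w)$.
   Context: $\operatorname{Bo}(T,\tau)$ denotes the Borel $\sigma$-algebra on a set $T$ generated by a topology $\tau$ on $T$, and $P(X)$ denotes the power set of $X$. $C(K)$ is the Banach space of real-valued continuous functions on $K$ with the sup-norm, and $C^*(K)$ is its topological dual. On $C^*(K)$, $w$ denotes the weak topology $\sigma(C^*(K),C^{**}(K))$ and $w^*$ denotes the weak-star topology $\sigma(C^*(K),C(K))$. *)

theory Defs
  imports "HOL-Analysis.Analysis"
begin

definition borel_sets_of :: "'a topology \<Rightarrow> 'a set set" where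
  "borel_sets_of T = sigma_sets (topspace T) {U. openin T U}"

lemma borel_sets_of_euclidean: "borel_sets_of euclidean = sets borel"
  by (simp add: borel_sets_of_def borel_def)

text \<open>
  The topological dual of a real normed space \<open>'a\<close> is the library type \<open>'a \<Rightarrow>\<^sub>L real\<close> of bounded
  linear functionals. When \<open>'k\<close> is compact, every continuous function on it is bounded, so
  \<open>'k \<Rightarrow>\<^sub>C real\<close> with its sup-norm is the Banach space of all continuous real-valued functions
  on \<open>'k\<close>.
\<close>

definition weak_topology :: "'a::real_normed_vector topology" where
  "weak_topology =
     topology_generated_by {blinfun_apply \<phi> -` U | (\<phi> :: 'a \<Rightarrow>\<^sub>L real) U. open U}"

definition weak_star_topology :: "('a::real_normed_vector \<Rightarrow>\<^sub>L real) topology" where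
  "weak_star_topology =
     topology_generated_by {(\<lambda>\<mu>. blinfun_apply \<mu> x) -` U | x U. open U}"

lemma topspace_weak_topology [simp]: "topspace weak_topology = UNIV"
proof -
  have "UNIV = blinfun_apply (0 :: 'a \<Rightarrow>\<^sub>L real) -` UNIV"
    by simp
  then show ?thesis
    unfolding weak_topology_def topology_generated_by_topspace by blast
qed

lemma topspace_weak_star_topology [simp]: "topspace weak_star_topology = UNIV"
proof -
  have "UNIV = (\<lambda>\<mu> :: 'a \<Rightarrow>\<^sub>L real. blinfun_apply \<mu> 0) -` UNIV"
    by simp
  then show ?thesis
    unfolding weak_star_topology_def topology_generated_by_topspace by blast
qed

lemma weak_star_topology_eq_strong_operator_topology:
  "weak_star_topology = (strong_operator_topology :: ('a::real_normed_vector \<Rightarrow>\<^sub>L real) topology)"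
proof -
  let ?B = "{(\<lambda>\<mu> :: 'a \<Rightarrow>\<^sub>L real. blinfun_apply \<mu> x) -` U | x U. open U}"
  have 1: "openin strong_operator_topology S" if "S \<in> ?B" for S
  proof -
    obtain x U where S: "S = (\<lambda>\<mu> :: 'a \<Rightarrow>\<^sub>L real. blinfun_apply \<mu> x) -` U" and U: "open U"
      using \<open>S \<in> ?B\<close> by blast
    have "openin strong_operator_topology
            {\<mu>. \<forall>i\<in>{()}. blinfun_apply \<mu> ((\<lambda>_. x) i) \<in> (\<lambda>_. U) i}"
      by (rule strong_operator_topology_basis) (use U in auto)
    then show ?thesis
      by (simp add: S vimage_def)
  qed
  have "continuous_map weak_star_topology euclidean (\<lambda>\<mu> :: 'a \<Rightarrow>\<^sub>L real. blinfun_apply \<mu> x)" for x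
  proof -
    have "openin weak_star_topology ((\<lambda>\<mu> :: 'a \<Rightarrow>\<^sub>L real. blinfun_apply \<mu> x) -` U)" if "open U" for U
      unfolding weak_star_topology_def by (rule topology_generated_by_Basis) (use that in blast)
    then show ?thesis
      by (simp add: continuous_map_def vimage_def)
  qed
  then have "continuous_map weak_star_topology strong_operator_topology (\<lambda>\<mu> :: 'a \<Rightarrow>\<^sub>L real. \<mu>)"
    by (simp add: continuous_on_strong_operator_topo_iff_coordinatewise)
  then have 2: "openin weak_star_topology S"
    if "openin strong_operator_topology S" for S :: "('a \<Rightarrow>\<^sub>L real) set"
    using that by (auto simp: continuous_map_def)
  have 3: "openin strong_operator_topology S" if "generate_topology_on ?B S" for S
    using that by induction (use 1 in auto)
  show ?thesis
    unfolding topology_eq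
    using 2 3 by (auto simp: weak_star_topology_def openin_topology_generated_by_iff)
qed

end

theory Submission
  imports Defs
begin

text \<open>
  Embed \<open>K\<close> into \<open>C*(K)\<close> by point evaluations, a weak-star continuous map. For each point \<open>k\<close>
  there is a functional \<open>\<phi>\<^sub>k\<close> on \<open>C*(K)\<close> (in measure terms \<open>\<mu> \<mapsto> \<mu>{k}\<close>) sending the evaluation at \<open>k\<close>
  to 1 and all others to 0; it is obtained from Urysohn functions by weak-star compactness rather
  than from the Riesz representation. Hence the union of the weakly open
  sets \<open>{\<mu>. \<phi>\<^sub>k \<mu> > 0}\<close> over \<open>k \<in> A\<close> pulls back to \<open>A\<close>, for an arbitrary subset \<open>A\<close> of \<open>K\<close>. If every weakly
  Borel set were weak-star Borel, then every such \<open>A\<close> would be Borel.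
\<close>

text \<open>Taking preimages commutes with generating a sigma-algebra, so only open sets have to be
  pulled back.\<close>

lemma borel_sets_of_vimage:
  assumes "continuous_map X Y f" "B \<in> borel_sets_of Y"
  shows "f -` B \<inter> topspace X \<in> borel_sets_of X"
proof -
  have f: "f \<in> topspace X \<rightarrow> topspace Y"
    using assms(1) by (rule continuous_map_funspace)
  have "f -` B \<inter> topspace X \<in> {f -` A \<inter> topspace X |A. A \<in> sigma_sets (topspace Y) {U. openin Y U}}"
    using assms(2) by (auto simp: borel_sets_of_def)
  also have "\<dots> = sigma_sets (topspace X) {f -` A \<inter> topspace X |A. A \<in> {U. openin Y U}}"
    by (rule sigma_sets_vimage_commute[OF f])
  also have "\<dots> \<subseteq> borel_sets_of X"
    unfolding borel_sets_of_def
  proof (rule sigma_sets_mono', safe)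
    fix U assume "openin Y U"
    moreover have "f -` U \<inter> topspace X = {x \<in> topspace X. f x \<in> U}" by auto
    ultimately show "openin X (f -` U \<inter> topspace X)"
      using assms(1) by (simp add: openin_continuous_map_preimage)
  qed
  finally show ?thesis .
qed

lemma openin_weak_topology_vimage:
  fixes \<phi> :: "'a::real_normed_vector \<Rightarrow>\<^sub>L real"
  assumes "open U"
  shows "openin weak_topology (blinfun_apply \<phi> -` U)"
  unfolding weak_topology_def by (rule topology_generated_by_Basis) (use assms in blast)

lemma continuous_map_weak_star_topology_iff:
  "continuous_map X weak_star_topology f \<longleftrightarrow>
     (\<forall>x. continuous_map X euclideanreal (\<lambda>t. blinfun_apply (f t) x))"
  by (simp add: weak_star_topology_eq_strong_operator_topology
      continuous_on_strong_operator_topo_iff_coordinatewise)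

text \<open>In the product topology on functions, linearity is a family of equations between
  continuous expressions in finitely many coordinates. Hence it survives the compactness argument
  below.\<close>

lemma closed_Collect_linear: "closed {g :: 'a::real_vector \<Rightarrow> real. linear g}"
proof -
  have "continuous_on UNIV (\<lambda>g :: 'a \<Rightarrow> real. g x)" for x
    by (rule continuous_on_product_coordinates)
  then show ?thesis
    unfolding linear_iff real_scaleR_def
    by (intro closed_Collect_conj closed_Collect_all closed_Collect_eq continuous_on_add
        continuous_on_mult_left)
qed

text \<open>The compactness argument is that of the Banach--Alaoglu theorem in the bidual.\<close>

lemma bidual_interpolation:
  fixes \<mu> :: "'i \<Rightarrow> ('a::real_normed_vector \<Rightarrow>\<^sub>L real)" and a :: "'i \<Rightarrow> real"
  assumes "\<And>I. finite I \<Longrightarrow> \<exists>x. norm x \<le> 1 \<and> (\<forall>i\<in>I. blinfun_apply (\<mu> i) x = a i)"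
  shows "\<exists>\<phi> :: ('a \<Rightarrow>\<^sub>L real) \<Rightarrow>\<^sub>L real. norm \<phi> \<le> 1 \<and> (\<forall>i. blinfun_apply \<phi> (\<mu> i) = a i)"
proof -
  \<comment> \<open>This box is compact by Tychonoff, and lying in it is exactly the bound needed
    for norm at most 1 in the bidual.\<close>
  define S :: "(('a \<Rightarrow>\<^sub>L real) \<Rightarrow> real) set" where "S = (\<Pi>\<^sub>E \<nu>\<in>UNIV. {- norm \<nu>..norm \<nu>})"
  \<comment> \<open>Linearity is built into each constraint set; types being inhabited, the
    intersection over all indices retains it.\<close>
  define Z where "Z i = {g :: ('a \<Rightarrow>\<^sub>L real) \<Rightarrow> real. linear g} \<inter> {g. g (\<mu> i) = a i}" for i
  have "compactin (product_topology (\<lambda>_. euclidean) UNIV) S"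
    unfolding S_def by (subst compactin_PiE) auto
  then have S: "compact S"
    by (simp add: euclidean_product_topology)
  have closed: "closed (Z i)" for i
    unfolding Z_def
    by (intro closed_Int closed_Collect_linear closed_Collect_eq continuous_on_const
        continuous_on_product_coordinates)
  have fip: "S \<inter> (\<Inter>i\<in>I. Z i) \<noteq> {}" if "finite I" for I
  proof -
    obtain x where x: "norm x \<le> 1" "\<forall>i\<in>I. blinfun_apply (\<mu> i) x = a i"
      using assms[OF \<open>finite I\<close>] by blast
    \<comment> \<open>The canonical image of \<open>x\<close> in the bidual meets the finitely many
      constraints.\<close>
    have "\<bar>blinfun_apply \<nu> x\<bar> \<le> norm \<nu>" for \<nu> :: "'a \<Rightarrow>\<^sub>L real"
      using norm_blinfun[of \<nu> x] mult_left_mono[OF x(1), of "norm \<nu>"] by simp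
    then have "(\<lambda>\<nu>. blinfun_apply \<nu> x) \<in> S"
      by (simp add: S_def PiE_iff abs_le_iff minus_le_iff)
    moreover have "linear (\<lambda>\<nu> :: 'a \<Rightarrow>\<^sub>L real. blinfun_apply \<nu> x)"
      by (simp add: linear_iff blinfun.add_left blinfun.scaleR_left)
    ultimately show ?thesis
      using x(2) by (auto simp: Z_def)
  qed
  have "S \<inter> (\<Inter>i\<in>UNIV. Z i) \<noteq> {}"
    by (rule compact_imp_fip_image[OF S closed fip])
  then obtain g where g: "g \<in> S" "linear g" "\<And>i. g (\<mu> i) = a i"
    by (auto simp: Z_def)
  have bound: "norm (g \<nu>) \<le> 1 * norm \<nu>" for \<nu>
    using g(1) by (simp add: S_def PiE_iff abs_le_iff minus_le_iff)
  have "bounded_linear g"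
    unfolding bounded_linear_def bounded_linear_axioms_def
    using g(2) bound by (intro conjI exI[of _ 1]) auto
  then have Blinfun: "blinfun_apply (Blinfun g) = g"
    by (rule bounded_linear_Blinfun_apply)
  have "norm (Blinfun g) \<le> 1"
    by (rule norm_blinfun_bound) (simp, unfold Blinfun, rule bound)
  then show ?thesis
    using g(3) Blinfun by metis
qed

definition evaluation :: "'k::topological_space \<Rightarrow> ('k \<Rightarrow>\<^sub>C real) \<Rightarrow>\<^sub>L real" where
  "evaluation k = Blinfun (\<lambda>f. apply_bcontfun f k)"

lemma evaluation_apply [simp]: "blinfun_apply (evaluation k) f = apply_bcontfun f k"
proof -
  have "bounded_linear (\<lambda>f :: 'a \<Rightarrow>\<^sub>C real. apply_bcontfun f k)"
    using norm_bounded[where 'b = real and x = k]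
    by (intro bounded_linear_intro[where K = 1]) auto
  then show ?thesis
    by (simp add: evaluation_def bounded_linear_Blinfun_apply)
qed

lemma continuous_map_evaluation: "continuous_map euclidean weak_star_topology evaluation"
  by (simp add: continuous_map_weak_star_topology_iff)

text \<open>A compact Hausdorff space is normal and finite sets are closed in it. The bound 1 does
  not depend on \<open>F\<close>, which is what lets compactness pass from finite sets to all
  points.\<close>

lemma Urysohn_bcontfun:
  fixes k :: "'k::t2_space"
  assumes "compact (UNIV :: 'k set)" "finite F" "k \<notin> F"
  shows "\<exists>f :: 'k \<Rightarrow>\<^sub>C real. norm f \<le> 1 \<and> apply_bcontfun f k = 1 \<and>
    (\<forall>j\<in>F. apply_bcontfun f j = 0)"
proof -
  have "Hausdorff_space (euclidean :: 'k topology)"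
    unfolding Hausdorff_space_def by (metis disjnt_def hausdorff open_openin)
  then have "normal_space (euclidean :: 'k topology)"
    using assms(1) by (simp add: compact_Hausdorff_or_regular_imp_normal_space compact_space_def)
  moreover have "closedin euclidean F" "closedin euclidean {k}" "disjnt F {k}"
    using assms by (auto simp: finite_imp_closed disjnt_def)
  ultimately obtain h where h: "continuous_map euclidean (top_of_set {0..1::real}) h"
      "h ` F \<subseteq> {0}" "h ` {k} \<subseteq> {1}"
    using Urysohn_lemma[of euclidean F "{k}" 0 1] by auto
  have cont: "continuous_on UNIV h" and range: "0 \<le> h x" "h x \<le> 1" for x
    using h(1) by (auto simp: continuous_map_in_subtopology)
  have "h \<in> bcontfun"
    using cont range by (intro bcontfun_normI[of _ 1]) auto
  then have "apply_bcontfun (Bcontfun h) = h"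
    by (simp add: Bcontfun_inverse)
  then show ?thesis
    using h range by (intro exI[of _ "Bcontfun h"]) (auto intro!: norm_bound)
qed

lemma atom_functional:
  fixes k :: "'k::t2_space"
  assumes "compact (UNIV :: 'k set)"
  shows "\<exists>\<phi> :: (('k \<Rightarrow>\<^sub>C real) \<Rightarrow>\<^sub>L real) \<Rightarrow>\<^sub>L real.
    \<forall>j. blinfun_apply \<phi> (evaluation j) = (if j = k then 1 else 0)"
proof -
  have "\<exists>f :: 'k \<Rightarrow>\<^sub>C real. norm f \<le> 1 \<and>
      (\<forall>j\<in>I. blinfun_apply (evaluation j) f = (if j = k then 1 else 0))" if "finite I" for I
    \<comment> \<open>Removing \<open>k\<close> from \<open>I\<close> is harmless, since the Urysohn
      function takes the value 1 at \<open>k\<close> in any case.\<close>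
    using Urysohn_bcontfun[OF assms, of "I - {k}" k] that by auto
  from bidual_interpolation[of evaluation "\<lambda>j. if j = k then 1 else 0", OF this]
  show ?thesis
    by metis
qed

theorem proposition3p1:
  assumes "compact (UNIV :: 'k::t2_space set)"
    and "borel_sets_of (euclidean :: 'k topology) \<noteq> Pow (UNIV :: 'k set)"
  shows "borel_sets_of (weak_star_topology :: (('k \<Rightarrow>\<^sub>C real) \<Rightarrow>\<^sub>L real) topology)
       \<noteq> borel_sets_of (weak_topology :: (('k \<Rightarrow>\<^sub>C real) \<Rightarrow>\<^sub>L real) topology)"
proof
  assume eq: "borel_sets_of (weak_star_topology :: (('k \<Rightarrow>\<^sub>C real) \<Rightarrow>\<^sub>L real) topology)
    = borel_sets_of weak_topology"
  obtain \<phi> :: "'k \<Rightarrow> (('k \<Rightarrow>\<^sub>C real) \<Rightarrow>\<^sub>L real) \<Rightarrow>\<^sub>L real"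
    where \<phi>: "\<And>k j. blinfun_apply (\<phi> k) (evaluation j) = (if j = k then 1 else 0)"
    using atom_functional[OF assms(1)] by metis
  have "A \<in> borel_sets_of euclidean" for A :: "'k set"
  proof -
    define W where "W = (\<Union>k\<in>A. blinfun_apply (\<phi> k) -` {0<..})"
    have "openin weak_topology W"
      unfolding W_def by (intro openin_Union) (auto intro: openin_weak_topology_vimage)
    then have "W \<in> borel_sets_of weak_star_topology"
      unfolding eq by (auto simp: borel_sets_of_def)
    then have "evaluation -` W \<inter> topspace euclidean \<in> borel_sets_of euclidean"
      by (rule borel_sets_of_vimage[OF continuous_map_evaluation])
    \<comment> \<open>The evaluation at \<open>j\<close> lies in the set with index \<open>k\<close>
      only for \<open>j = k\<close>, so it lies in the union exactly when \<open>j\<close> is in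
      \<open>A\<close>.\<close>
    moreover have "evaluation -` W = A"
      by (auto simp: W_def \<phi> split: if_splits)
    ultimately show ?thesis
      by simp
  qed
  then show False
    using assms(2) by blast
qed

end
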